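(* Let $H$ be a self-adjoint operator with domain $\mathcal{D}_H$ on a Hilbert space $\mathcal{H}$, with purely discrete spectrum; let $\lambda_j$ be its eigenvalues (counted with multiplicity) and $\{\phi_j\}$ a corresponding orthonormal basis of $\mathcal{H}$ consisting of eigenfunctions, $H\phi_j=\lambda_j\phi_j$. Let $G$ be a linear operator with domain $\mathcal{D}_G$ and adjoint $G^*$ defined on $\mathcal{D}_{G^*}$ such that $G(\mathcal{D}_H)\subseteq\mathcal{D}_H\subseteq\mathcal{D}_G$ and $G^*(\mathcal{D}_H)\subseteq\mathcal{D}_H\subseteq\mathcal{D}_{G^*}$. Fix a subset $J$ of the spectrum of $H$. Then for all $z\in\mathbb{R}$, $$\frac12\sum_{\lambda_j\in J}(z-\lambda_j)^2\big(\langle[G^*,[H,G]]\phi_j,\phi_j\rangle+\langle[G,[H,G^*]]\phi_j,\phi_j\rangle\big)-\sum_{\lambda_j\in J}(z-\lambda_j)\big(\|[H,G]\phi_j\|^2+\|[H,G^*]\phi_j\|^2\big)$$ $$=\sum_{\lambda_j\in J}\sum_{\lambda_k\notin J}(z-\lambda_j)(z-\lambda_k)(\lambda_k-\lambda_j)\big(|\langle G\phi_j,\phi_k\rangle|^2+|\langle G^*\phi_j,\phi_k\rangle|^2\big).$$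
   Context: $[A,B]:=AB-BA$ denotes the commutator. The sums over $j$ (resp. $k$) run over all indices with $\lambda_j\in J$ (resp. $\lambda_k\notin J$). The identity is understood for the case in which the sums and the second-commutator expectation values (in the sense of quadratic forms) appearing in it are well defined. *)

theory Defs
  imports "HOL-Analysis.Analysis"
begin

section \<open>Complex Hilbert spaces\<close>

text \<open>The inner product is linear in the first and conjugate-linear in the second argument.\<close>

class complex_inner = real_normed_vector +
  fixes scaleC :: "complex \<Rightarrow> 'a \<Rightarrow> 'a"  (infixr \<open>*\<^sub>C\<close> 75)
    and cinner :: "'a \<Rightarrow> 'a \<Rightarrow> complex"
  assumes scaleR_scaleC: "r *\<^sub>R x = complex_of_real r *\<^sub>C x"
    and scaleC_add_right: "a *\<^sub>C (x + y) = a *\<^sub>C x + a *\<^sub>C y"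
    and scaleC_add_left: "(a + b) *\<^sub>C x = a *\<^sub>C x + b *\<^sub>C x"
    and scaleC_scaleC: "a *\<^sub>C b *\<^sub>C x = (a * b) *\<^sub>C x"
    and scaleC_one: "1 *\<^sub>C x = x"
    and cinner_commute: "cinner x y = cnj (cinner y x)"
    and cinner_add_left: "cinner (x + y) z = cinner x z + cinner y z"
    and cinner_scaleC_left: "cinner (a *\<^sub>C x) y = a * cinner x y"
    and cinner_self: "cinner x x = complex_of_real ((norm x)\<^sup>2)"

class complex_hilbert_space = complex_inner + complete_space

instantiation complex :: complex_hilbert_space
begin

definition scaleC_complex :: "complex \<Rightarrow> complex \<Rightarrow> complex"
  where "scaleC_complex a x = a * x"

definition cinner_complex :: "complex \<Rightarrow> complex \<Rightarrow> complex"
  where "cinner_complex x y = x * cnj y"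

instance
proof
  fix x y z a b :: complex and r :: real
  show "r *\<^sub>R x = complex_of_real r *\<^sub>C x"
    by (simp add: scaleC_complex_def scaleR_conv_of_real)
  show "a *\<^sub>C (x + y) = a *\<^sub>C x + a *\<^sub>C y" "(a + b) *\<^sub>C x = a *\<^sub>C x + b *\<^sub>C x"
    "a *\<^sub>C b *\<^sub>C x = (a * b) *\<^sub>C x" "1 *\<^sub>C x = x"
    by (simp_all add: scaleC_complex_def distrib_left distrib_right mult.assoc)
  show "cinner x y = cnj (cinner y x)" "cinner (x + y) z = cinner x z + cinner y z"
    "cinner (a *\<^sub>C x) y = a * cinner x y"
    by (simp_all add: cinner_complex_def scaleC_complex_def algebra_simps)
  show "cinner x x = complex_of_real ((norm x)\<^sup>2)"
    unfolding cinner_complex_def by (rule complex_norm_square[symmetric])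
qed

end

global_interpretation complex_vector:
  vector_space "scaleC :: complex \<Rightarrow> 'a \<Rightarrow> 'a::complex_inner"
  by unfold_locales (simp_all only: scaleC_add_right scaleC_add_left scaleC_scaleC scaleC_one)

definition orthonormal_basis :: "'i set \<Rightarrow> ('i \<Rightarrow> 'a::complex_inner) \<Rightarrow> bool" where
  "orthonormal_basis I \<phi> \<longleftrightarrow>
     (\<forall>i\<in>I. \<forall>j\<in>I. cinner (\<phi> i) (\<phi> j) = (if i = j then 1 else 0)) \<and>
     closure (complex_vector.span (\<phi> ` I)) = UNIV"


section \<open>Unbounded operators\<close>

text \<open>An operator is a domain together with a function; the values of the function outside
  the domain are irrelevant.\<close>

datatype 'a operator = Operator (op_dom: "'a set") (op_app: "'a \<Rightarrow> 'a")

notation op_app (infixr \<open>\<cdot>\<close> 85)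

definition linear_operator :: "'a::complex_inner operator \<Rightarrow> bool" where
  "linear_operator T \<longleftrightarrow>
     complex_vector.subspace (op_dom T) \<and>
     (\<forall>x\<in>op_dom T. \<forall>y\<in>op_dom T. T \<cdot> (x + y) = T \<cdot> x + T \<cdot> y) \<and>
     (\<forall>a. \<forall>x\<in>op_dom T. T \<cdot> (a *\<^sub>C x) = a *\<^sub>C (T \<cdot> x))"

definition densely_defined :: "'a::complex_inner operator \<Rightarrow> bool" where
  "densely_defined T \<longleftrightarrow> closure (op_dom T) = UNIV"

text \<open>The adjoint is meaningful for densely defined operators only, because otherwise the
  vector \<open>w\<close> is not unique.\<close>

definition adj :: "'a::complex_inner operator \<Rightarrow> 'a operator" where
  "adj T = Operator
     {y. \<exists>w. \<forall>x\<in>op_dom T. cinner (T \<cdot> x) y = cinner x w}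
     (\<lambda>y. THE w. \<forall>x\<in>op_dom T. cinner (T \<cdot> x) y = cinner x w)"

definition self_adjoint :: "'a::complex_inner operator \<Rightarrow> bool" where
  "self_adjoint T \<longleftrightarrow>
     linear_operator T \<and> densely_defined T \<and>
     op_dom (adj T) = op_dom T \<and> (\<forall>x\<in>op_dom T. adj T \<cdot> x = T \<cdot> x)"

definition resolvent_set :: "'a::complex_inner operator \<Rightarrow> complex set" where
  "resolvent_set T = {z.
     bij_betw (\<lambda>x. T \<cdot> x - z *\<^sub>C x) (op_dom T) UNIV \<and>
     (\<exists>C. \<forall>x\<in>op_dom T. norm x \<le> C * norm (T \<cdot> x - z *\<^sub>C x))}"

definition spectrum :: "'a::complex_inner operator \<Rightarrow> complex set" where
  "spectrum T = - resolvent_set T"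

definition eigenspace :: "'a::complex_inner operator \<Rightarrow> complex \<Rightarrow> 'a set" where
  "eigenspace T z = {x \<in> op_dom T. T \<cdot> x = z *\<^sub>C x}"

text \<open>Every point of the spectrum is isolated and an eigenvalue of finite multiplicity.\<close>

definition purely_discrete_spectrum :: "'a::complex_inner operator \<Rightarrow> bool" where
  "purely_discrete_spectrum T \<longleftrightarrow>
     (\<forall>z\<in>spectrum T. z isolated_in spectrum T \<and> eigenspace T z \<noteq> {0} \<and>
        (\<exists>B. finite B \<and> eigenspace T z \<subseteq> complex_vector.span B))"


section \<open>Commutators\<close>

text \<open>Products and differences carry their natural domains.\<close>

definition op_comp :: "'a operator \<Rightarrow> 'a operator \<Rightarrow> 'a operator" where
  "op_comp A B = Operator {x \<in> op_dom B. B \<cdot> x \<in> op_dom A} (\<lambda>x. A \<cdot> B \<cdot> x)"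

definition op_diff :: "'a::complex_inner operator \<Rightarrow> 'a operator \<Rightarrow> 'a operator" where
  "op_diff A B = Operator (op_dom A \<inter> op_dom B) (\<lambda>x. A \<cdot> x - B \<cdot> x)"

definition commutator :: "'a::complex_inner operator \<Rightarrow> 'a operator \<Rightarrow> 'a operator" where
  "commutator A B = op_diff (op_comp A B) (op_comp B A)"

text \<open>The expression \<open>\<langle>[A, B] u, v\<rangle>\<close> in the sense of quadratic forms: the outer factors of
  \<open>AB\<close> and \<open>BA\<close> are moved to the other side, so that \<open>u\<close> need not lie in the domain of the
  operator \<open>[A, B]\<close>.  The form is defined for \<open>u\<close> in the domains of \<open>A\<close> and \<open>B\<close> and \<open>v\<close> in
  the domains of \<open>A\<^sup>*\<close> and \<open>B\<^sup>*\<close>.  By \<open>commutator_form_eq\<close> below it agrees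
  with the value of the operator whenever \<open>u\<close> lies in the domain of \<open>[A, B]\<close>.\<close>

definition commutator_form ::
    "'a::complex_inner operator \<Rightarrow> 'a operator \<Rightarrow> 'a \<Rightarrow> 'a \<Rightarrow> complex" where
  "commutator_form A B u v = cinner (B \<cdot> u) (adj A \<cdot> v) - cinner (A \<cdot> u) (adj B \<cdot> v)"


section \<open>Basic properties\<close>

lemma cinner_add_right: "cinner x (y + z) = cinner x y + cinner x (z::'a::complex_inner)"
  by (metis cinner_add_left cinner_commute complex_cnj_add)

lemma cinner_scaleC_right: "cinner x (a *\<^sub>C y) = cnj a * cinner x (y::'a::complex_inner)"
  by (metis cinner_scaleC_left cinner_commute complex_cnj_mult)

lemma cinner_zero_left [simp]: "cinner 0 (y::'a::complex_inner) = 0"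
  using cinner_add_left[of 0 0 y] by simp

lemma cinner_zero_right [simp]: "cinner (x::'a::complex_inner) 0 = 0"
  using cinner_add_right[of x 0 0] by simp

lemma cinner_minus_left: "cinner (- x) y = - cinner x (y::'a::complex_inner)"
  using cinner_add_left[of x "- x" y] by (simp add: add_eq_0_iff)

lemma cinner_minus_right: "cinner x (- y) = - cinner x (y::'a::complex_inner)"
  using cinner_add_right[of x y "- y"] by (simp add: add_eq_0_iff)

lemma cinner_diff_left: "cinner (x - y) z = cinner x z - cinner y (z::'a::complex_inner)"
  using cinner_add_left[of x "- y" z] by (simp add: cinner_minus_left)

lemma cinner_diff_right: "cinner x (y - z) = cinner x y - cinner x (z::'a::complex_inner)"
  using cinner_add_right[of x y "- z"] by (simp add: cinner_minus_right)

lemma dense_orthogonal_zero: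
  fixes d :: "'a::complex_inner"
  assumes "closure S = UNIV" and orth: "\<And>x. x \<in> S \<Longrightarrow> cinner x d = 0"
  shows "d = 0"
proof (rule ccontr)
  assume "d \<noteq> 0"
  then have "norm d > 0" by simp
  then obtain x where x: "x \<in> S" "dist x d < norm d"
    using assms(1) closure_approachable by blast
  have "cinner d x = 0"
    using orth[OF x(1)] cinner_commute[of d x] by simp
  then have "cinner (x - d) (x - d) = cinner x x + cinner d d"
    using orth[OF x(1)] by (simp add: cinner_diff_left cinner_diff_right)
  then have "complex_of_real ((norm (x - d))\<^sup>2) = complex_of_real ((norm x)\<^sup>2 + (norm d)\<^sup>2)"
    by (simp only: cinner_self of_real_add)
  then have "(norm (x - d))\<^sup>2 = (norm x)\<^sup>2 + (norm d)\<^sup>2"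
    by (simp only: of_real_eq_iff)
  moreover have "(norm (x - d))\<^sup>2 < (norm d)\<^sup>2"
    using x(2) by (simp add: dist_norm power_strict_mono)
  ultimately show False
    by (smt (verit) zero_le_power2)
qed

lemma adj_eqI:
  assumes "densely_defined T" "\<And>x. x \<in> op_dom T \<Longrightarrow> cinner (T \<cdot> x) y = cinner x w"
  shows "y \<in> op_dom (adj T)" and "adj T \<cdot> y = w"
proof -
  have ex: "\<forall>x\<in>op_dom T. cinner (T \<cdot> x) y = cinner x w"
    using assms(2) by blast
  then show "y \<in> op_dom (adj T)"
    unfolding adj_def operator.sel by blast
  have "w' = w" if w': "\<forall>x\<in>op_dom T. cinner (T \<cdot> x) y = cinner x w'" for w'
  proof -
    have "cinner x (w' - w) = 0" if "x \<in> op_dom T" for x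
      using bspec[OF ex that] bspec[OF w' that] unfolding cinner_diff_right by simp
    then have "w' - w = 0"
      using dense_orthogonal_zero assms(1) unfolding densely_defined_def by blast
    then show ?thesis by simp
  qed
  with ex show "adj T \<cdot> y = w"
    unfolding adj_def operator.sel by (rule the_equality)
qed

lemma cinner_adj:
  assumes "densely_defined T" "x \<in> op_dom T" "y \<in> op_dom (adj T)"
  shows "cinner (T \<cdot> x) y = cinner x (adj T \<cdot> y)"
proof -
  obtain w where w: "\<forall>x\<in>op_dom T. cinner (T \<cdot> x) y = cinner x w"
    using assms(3) unfolding adj_def operator.sel by blast
  then have "adj T \<cdot> y = w"
    using adj_eqI(2)[OF assms(1)] by blast
  then show ?thesis
    using w assms(2) by blast
qed

lemma commutator_form_eq:
  assumes "densely_defined A" "densely_defined B"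
    and "u \<in> op_dom (commutator A B)" "v \<in> op_dom (adj A)" "v \<in> op_dom (adj B)"
  shows "commutator_form A B u v = cinner (commutator A B \<cdot> u) v"
proof -
  have "A \<cdot> u \<in> op_dom B" "B \<cdot> u \<in> op_dom A"
    using assms(3) by (simp_all add: commutator_def op_diff_def op_comp_def)
  then have "cinner (A \<cdot> B \<cdot> u) v = cinner (B \<cdot> u) (adj A \<cdot> v)"
    and "cinner (B \<cdot> A \<cdot> u) v = cinner (A \<cdot> u) (adj B \<cdot> v)"
    using assms cinner_adj by blast+
  then show ?thesis
    by (simp add: commutator_form_def commutator_def op_diff_def op_comp_def cinner_diff_left)
qed

end

theory Submission
  imports Defs
begin

text \<open>
  Write \<open>w\<^sub>j\<^sub>k = |\<langle>G\<phi>\<^sub>j, \<phi>\<^sub>k\<rangle>|\<^sup>2 + |\<langle>G\<^sup>*\<phi>\<^sub>j, \<phi>\<^sub>k\<rangle>|\<^sup>2\<close>, which is symmetric in \<open>j\<close> and \<open>k\<close>.  On an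
  eigenvector the commutator is \<open>[H, G]\<phi>\<^sub>j = (H - \<lambda>\<^sub>j)G\<phi>\<^sub>j\<close>, with coefficients
  \<open>(\<lambda>\<^sub>k - \<lambda>\<^sub>j)\<langle>G\<phi>\<^sub>j, \<phi>\<^sub>k\<rangle>\<close> in the basis.  Parseval's identity therefore gives
  \<open>\<Sum>\<^sub>k (\<lambda>\<^sub>k - \<lambda>\<^sub>j) w\<^sub>j\<^sub>k\<close> for each of the two double commutator forms at \<open>\<phi>\<^sub>j\<close>
  (\<open>commutator_form_has_sum\<close>), and \<open>\<Sum>\<^sub>k (\<lambda>\<^sub>k - \<lambda>\<^sub>j)\<^sup>2 w\<^sub>j\<^sub>k\<close> for
  \<open>\<parallel>[H, G]\<phi>\<^sub>j\<parallel>\<^sup>2 + \<parallel>[H, G\<^sup>*]\<phi>\<^sub>j\<parallel>\<^sup>2\<close> (\<open>commutator_norms_has_sum\<close>).  Because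
  \<open>(z - \<lambda>\<^sub>j)\<^sup>2(\<lambda>\<^sub>k - \<lambda>\<^sub>j) - (z - \<lambda>\<^sub>j)(\<lambda>\<^sub>k - \<lambda>\<^sub>j)\<^sup>2 = (z - \<lambda>\<^sub>j)(z - \<lambda>\<^sub>k)(\<lambda>\<^sub>k - \<lambda>\<^sub>j)\<close>,
  the \<open>j\<close>-th term on the left is \<open>\<Sum>\<^sub>k a\<^sub>j\<^sub>k\<close> over all \<open>k\<close>, where
  \<open>a\<^sub>j\<^sub>k = (z - \<lambda>\<^sub>j)(z - \<lambda>\<^sub>k)(\<lambda>\<^sub>k - \<lambda>\<^sub>j) w\<^sub>j\<^sub>k\<close>.

  The terms with \<open>\<lambda>\<^sub>k \<notin> J\<close> make up the right-hand side, so the iterated sum of \<open>a\<^sub>j\<^sub>k\<close> over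
  \<open>\<lambda>\<^sub>j, \<lambda>\<^sub>k \<in> J\<close> has to vanish.  The array \<open>a\<close> is antisymmetric, which settles the
  matter when \<open>J\<close> contains finitely many eigenvalues.  For infinitely many the double series
  need not converge absolutely, and antisymmetry alone does not determine its iterated sum: mass
  could escape to infinity.  It does not, for two reasons.  The spectrum is discrete, so only
  finitely many eigenvalues lie in a bounded set (\<open>finite_bounded_eigenvalues\<close>).  And the
  convergence of the norm series says that \<open>|z - \<lambda>\<^sub>j|(\<lambda>\<^sub>k - \<lambda>\<^sub>j)\<^sup>2 w\<^sub>j\<^sub>k\<close> is summable over
  pairs, which dominates the antisymmetrised terms under a piecewise linear cutoff.  The lemma
  \<open>antisymmetric_exchange_zero\<close> carries out this argument.
\<close>

section \<open>Unconditional sums\<close>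

text \<open>Dominated convergence for the counting measure on \<open>A\<close>.\<close>

lemma tendsto_infsum_dominated:
  fixes f :: "nat \<Rightarrow> 'i \<Rightarrow> real"
  assumes M: "M summable_on A"
    and bound: "\<And>n i. i \<in> A \<Longrightarrow> \<bar>f n i\<bar> \<le> M i"
    and lim: "\<And>i. i \<in> A \<Longrightarrow> (\<lambda>n. f n i) \<longlonglongrightarrow> g i"
  shows "(\<lambda>n. infsum (f n) A) \<longlonglongrightarrow> infsum g A"
proof -
  have int: "integrable (count_space A) h" "infsum h A = lebesgue_integral (count_space A) h"
    if "\<And>i. i \<in> A \<Longrightarrow> \<bar>h i\<bar> \<le> M i" for h :: "'i \<Rightarrow> real"
  proof -
    have "Infinite_Set_Sum.abs_summable_on h A"
      using Infinite_Sum.abs_summable_on_comparison_test'[OF M, of h] that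
      by (simp flip: abs_summable_equivalent)
    then show "integrable (count_space A) h"
      and "infsum h A = lebesgue_integral (count_space A) h"
      by (simp_all add: Infinite_Set_Sum.abs_summable_on_def infsetsum_infsum[symmetric]
          infsetsum_def)
  qed
  have g: "\<bar>g i\<bar> \<le> M i" if "i \<in> A" for i
    using tendsto_le[OF sequentially_bot tendsto_const tendsto_rabs[OF lim[OF that]]]
      bound[OF that] by simp
  have "integrable (count_space A) M"
    using order_trans[OF abs_ge_zero bound] by (intro int) simp
  then have "(\<lambda>n. lebesgue_integral (count_space A) (f n)) \<longlonglongrightarrow> lebesgue_integral (count_space A) g"
    by (intro integral_dominated_convergence[where w = M])
       (use lim bound in \<open>auto simp: AE_count_space\<close>)
  then show ?thesis
    using int(2)[OF bound] int(2)[OF g] by simp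
qed

lemma summable_on_diff:
  fixes f g :: "'i \<Rightarrow> 'b::topological_ab_group_add"
  assumes "f summable_on A" "g summable_on A"
  shows "(\<lambda>i. f i - g i) summable_on A"
  using summable_on_add[OF assms(1), of "\<lambda>i. - g i"] assms(2) by (simp add: summable_on_uminus)

lemma infsum_diff:
  fixes f g :: "'i \<Rightarrow> 'b::{topological_ab_group_add, t2_space}"
  assumes "f summable_on A" "g summable_on A"
  shows "(\<Sum>\<^sub>\<infinity>i\<in>A. f i - g i) = infsum f A - infsum g A"
  using infsum_add[OF assms(1), of "\<lambda>i. - g i"] assms(2)
  by (simp add: summable_on_uminus infsum_uminus)

section \<open>Cancellation in antisymmetric double series\<close>

definition tent :: "real \<Rightarrow> real \<Rightarrow> real" where
  "tent R t = max 0 (1 - \<bar>t\<bar> / R)"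

lemma tent_eq_0: "R > 0 \<Longrightarrow> \<bar>t\<bar> \<ge> R \<Longrightarrow> tent R t = 0"
  by (simp add: tent_def)

lemma tent_bounds: "R > 0 \<Longrightarrow> 0 \<le> tent R t" "R > 0 \<Longrightarrow> tent R t \<le> 1"
  by (simp_all add: tent_def)

lemma tent_tendsto: "(\<lambda>n. tent (real (Suc n)) t) \<longlonglongrightarrow> 1"
proof -
  have "(\<lambda>n. max 0 (1 - \<bar>t\<bar> * inverse (real (Suc n)))) \<longlonglongrightarrow> max 0 (1 - \<bar>t\<bar> * 0)"
    by (intro tendsto_intros LIMSEQ_inverse_real_of_nat)
  then show ?thesis
    by (simp add: tent_def divide_inverse)
qed

text \<open>The slope \<open>1 / R\<close> of the cutoff is traded for the position of an argument, since the
  cutoff is constant beyond \<open>R\<close>.  The resulting bound does not depend on \<open>R\<close>, and this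
  uniformity is what allows the limit \<open>R \<rightarrow> \<infinity>\<close> under a sum.\<close>

lemma tent_scale_invariant_Lipschitz:
  assumes "R > 0"
  shows "\<bar>s\<bar> * \<bar>tent R s - tent R t\<bar> \<le> \<bar>s - t\<bar>"
proof -
  have key: "v * \<bar>max 0 (1 - u / R) - max 0 (1 - v / R)\<bar> \<le> v - u"
    if "0 \<le> u" "u \<le> v" for u v :: real
  proof -
    consider "v \<le> R" | "u \<le> R" "R \<le> v" | "R \<le> u"
      by linarith
    then show ?thesis
    proof cases
      case 1
      then have "u / R \<le> 1" "v / R \<le> 1" "u / R \<le> v / R"
        using assms that by (simp_all add: divide_right_mono)
      then have "\<bar>max 0 (1 - u / R) - max 0 (1 - v / R)\<bar> = (v - u) / R"
        by (simp add: diff_divide_distrib)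
      then have "v * \<bar>max 0 (1 - u / R) - max 0 (1 - v / R)\<bar> = (v / R) * (v - u)"
        by simp
      also have "\<dots> \<le> 1 * (v - u)"
        using \<open>v / R \<le> 1\<close> that by (intro mult_right_mono) auto
      finally show ?thesis by simp
    next
      case 2
      then have "u / R \<le> 1" "1 \<le> v / R"
        using assms by simp_all
      then have "v * \<bar>max 0 (1 - u / R) - max 0 (1 - v / R)\<bar> = v - u * (v / R)"
        by (simp add: field_simps)
      also have "\<dots> \<le> v - u * 1"
        using \<open>1 \<le> v / R\<close> that by (intro diff_left_mono mult_left_mono) auto
      finally show ?thesis by simp
    next
      case 3
      then have "1 \<le> u / R" "1 \<le> v / R"
        using assms that by simp_all
      then show ?thesis using that by simp
    qed
  qed
  show ?thesis
  proof (cases "\<bar>t\<bar> \<le> \<bar>s\<bar>")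
    case True
    have "\<bar>s\<bar> * \<bar>tent R s - tent R t\<bar> = \<bar>s\<bar> * \<bar>tent R t - tent R s\<bar>"
      by (simp add: abs_minus_commute)
    also have "\<dots> \<le> \<bar>s\<bar> - \<bar>t\<bar>"
      using key[of "\<bar>t\<bar>" "\<bar>s\<bar>"] True by (simp add: tent_def)
    finally show ?thesis by linarith
  next
    case False
    have "\<bar>s\<bar> * \<bar>tent R s - tent R t\<bar> \<le> \<bar>t\<bar> * \<bar>tent R s - tent R t\<bar>"
      using False by (intro mult_right_mono) auto
    also have "\<dots> \<le> \<bar>t\<bar> - \<bar>s\<bar>"
      using key[of "\<bar>s\<bar>" "\<bar>t\<bar>"] False by (simp add: tent_def)
    finally show ?thesis by linarith
  qed
qed

text \<open>Multiply the row sums by a cutoff \<open>\<tau>\<^sub>j\<close> that vanishes for \<open>|x\<^sub>j| \<ge> R\<close>.  Only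
  finitely many rows survive, so the double series converges absolutely and equals
  \<open>1/2 \<Sum> (\<tau>\<^sub>j - \<tau>\<^sub>k) a\<^sub>j\<^sub>k\<close> by antisymmetry.  The Lipschitz bound for the cutoff absorbs the
  factor \<open>|x\<^sub>k|\<close> of \<open>a\<^sub>j\<^sub>k\<close>, so these terms are dominated by
  \<open>|x\<^sub>j|(x\<^sub>k - x\<^sub>j)\<^sup>2 w\<^sub>j\<^sub>k\<close> uniformly in \<open>R\<close>, while each of them tends to \<open>0\<close> as
  \<open>R \<rightarrow> \<infinity>\<close>.\<close>

lemma antisymmetric_exchange_zero:
  fixes x :: "'i \<Rightarrow> real" and w :: "'i \<Rightarrow> 'i \<Rightarrow> real"
  defines "a \<equiv> \<lambda>j k. x j * x k * (x k - x j) * w j k"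
  assumes fin: "\<And>R. finite {j \<in> A. \<bar>x j\<bar> \<le> R}"
    and sym: "\<And>j k. j \<in> A \<Longrightarrow> k \<in> A \<Longrightarrow> w j k = w k j" and nonneg: "\<And>j k. w j k \<ge> 0"
    and sq: "\<And>j. j \<in> A \<Longrightarrow> (\<lambda>k. (x k - x j)\<^sup>2 * w j k) summable_on A"
    and dom: "(\<lambda>j. \<bar>x j\<bar> * (\<Sum>\<^sub>\<infinity>k\<in>A. (x k - x j)\<^sup>2 * w j k)) summable_on A"
    and row: "\<And>j. j \<in> A \<Longrightarrow> a j summable_on A"
    and rows: "(\<lambda>j. \<Sum>\<^sub>\<infinity>k\<in>A. a j k) summable_on A"
  shows "(\<Sum>\<^sub>\<infinity>j\<in>A. \<Sum>\<^sub>\<infinity>k\<in>A. a j k) = 0"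
proof -
  \<comment> \<open>\<open>D\<close> dominates \<open>d n\<close>, the antisymmetrised array at cutoff radius \<open>n + 1\<close>.\<close>
  define b where "b = (\<lambda>j. \<Sum>\<^sub>\<infinity>k\<in>A. a j k)"
  define \<tau> where "\<tau> n j = tent (real (Suc n)) (x j)" for n j
  define d where "d n = (\<lambda>(j, k). (\<tau> n j - \<tau> n k) * a j k)" for n
  define D where "D = (\<lambda>(j, k). \<bar>x j\<bar> * ((x k - x j)\<^sup>2 * w j k))"
  have D: "D summable_on A \<times> A"
    unfolding D_def
  proof (rule summable_on_SigmaI[OF _ dom])
    fix j assume "j \<in> A"
    then show "((\<lambda>k. case (j, k) of (j, k) \<Rightarrow> \<bar>x j\<bar> * ((x k - x j)\<^sup>2 * w j k)) has_sum
        \<bar>x j\<bar> * (\<Sum>\<^sub>\<infinity>k\<in>A. (x k - x j)\<^sup>2 * w j k)) A"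
      using has_sum_cmult_right[OF has_sum_infsum[OF sq]] by simp
  qed (simp add: nonneg)
  have anti: "a k j = - a j k" if "j \<in> A" "k \<in> A" for j k
    unfolding a_def sym[OF that(2,1)] by (simp add: algebra_simps)
  have dD: "\<bar>d n p\<bar> \<le> D p" for n p
  proof -
    obtain j k where p: "p = (j, k)" by fastforce
    have "\<bar>d n p\<bar> = \<bar>x k\<bar> * \<bar>\<tau> n k - \<tau> n j\<bar> * (\<bar>x j\<bar> * \<bar>x k - x j\<bar> * w j k)"
      by (simp add: p d_def a_def abs_mult nonneg abs_minus_commute)
    also have "\<dots> \<le> \<bar>x k - x j\<bar> * (\<bar>x j\<bar> * \<bar>x k - x j\<bar> * w j k)"
      unfolding \<tau>_def
      by (intro mult_right_mono tent_scale_invariant_Lipschitz) (simp_all add: nonneg)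
    also have "\<dots> = \<bar>x j\<bar> * (\<bar>x k - x j\<bar> * \<bar>x k - x j\<bar> * w j k)"
      by (simp only: mult_ac)
    also have "\<dots> = D p"
      by (simp add: p D_def power2_eq_square)
    finally show ?thesis .
  qed
  have "(\<lambda>n. infsum (d n) (A \<times> A)) \<longlonglongrightarrow> infsum (\<lambda>p. 0) (A \<times> A)"
  proof (rule tendsto_infsum_dominated[OF D dD])
    fix p :: "'i \<times> 'i"
    obtain j k where p: "p = (j, k)" by fastforce
    have "(\<lambda>n. (\<tau> n j - \<tau> n k) * a j k) \<longlonglongrightarrow> (1 - 1) * a j k"
      unfolding \<tau>_def by (intro tendsto_intros tent_tendsto)
    then show "(\<lambda>n. d n p) \<longlonglongrightarrow> 0"
      by (simp add: p d_def)
  qed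
  then have lim0: "(\<lambda>n. infsum (d n) (A \<times> A)) \<longlonglongrightarrow> 0"
    by simp
  have "(\<lambda>n. \<Sum>\<^sub>\<infinity>j\<in>A. \<tau> n j * b j) \<longlonglongrightarrow> infsum b A"
  proof (rule tendsto_infsum_dominated[where M = "\<lambda>j. \<bar>b j\<bar>"])
    show "(\<lambda>j. \<bar>b j\<bar>) summable_on A"
      using rows summable_on_iff_abs_summable_on_real[of b A] by (simp flip: b_def)
    show "\<bar>\<tau> n j * b j\<bar> \<le> \<bar>b j\<bar>" for n j
      using tent_bounds[of "real (Suc n)" "x j"]
      by (simp add: \<tau>_def abs_mult mult_left_le_one_le)
    show "(\<lambda>n. \<tau> n j * b j) \<longlonglongrightarrow> b j" for j
      using tendsto_mult[OF tent_tendsto[of "x j"] tendsto_const[of "b j"]] by (simp add: \<tau>_def)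
  qed
  moreover have "infsum (d n) (A \<times> A) = 2 * (\<Sum>\<^sub>\<infinity>j\<in>A. \<tau> n j * b j)" for n
  proof -
    define c where "c = (\<lambda>(j, k). \<tau> n j * a j k)"
    have "c summable_on A \<times> A"
    proof -
      define F where "F = {j \<in> A. \<bar>x j\<bar> \<le> real (Suc n)}"
      \<comment> \<open>Absolute summability holds in each row, and the cutoff leaves the finitely many rows
        in \<open>F\<close>.\<close>
      have "(\<lambda>k. norm (c (j, k))) summable_on A" if "j \<in> A" for j
        unfolding c_def prod.case summable_on_iff_abs_summable_on_real[symmetric]
        by (intro summable_on_cmult_right row that)
      then have "(\<lambda>p. norm (c p)) summable_on F \<times> A"
        using fin[of "real (Suc n)"]
        unfolding Infinite_Sum.abs_summable_on_Sigma_iff by (auto simp: F_def)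
      then have cF: "c summable_on F \<times> A"
        using summable_on_iff_abs_summable_on_real by blast
      have zero: "c (j, k) = 0" if "j \<in> A" "j \<notin> F" for j k
      proof -
        have "\<bar>x j\<bar> \<ge> real (Suc n)"
          using that unfolding F_def by simp
        then have "\<tau> n j = 0"
          unfolding \<tau>_def by (intro tent_eq_0) simp_all
        then show ?thesis
          by (simp add: c_def)
      qed
      have "c summable_on F \<times> A \<longleftrightarrow> c summable_on A \<times> A"
        by (rule summable_on_cong_neutral) (use zero in \<open>auto simp: F_def\<close>)
      then show ?thesis
        using cF by blast
    qed
    note c = this
    have c': "(c \<circ> prod.swap) summable_on A \<times> A"
      using c summable_on_reindex[of prod.swap "A \<times> A" c] by (simp add: product_swap)
    have "infsum (c \<circ> prod.swap) (A \<times> A) = infsum c (A \<times> A)"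
      using infsum_reindex[of prod.swap "A \<times> A" c] by (simp add: product_swap)
    moreover have "infsum (d n) (A \<times> A) = infsum (\<lambda>p. c p + (c \<circ> prod.swap) p) (A \<times> A)"
    proof (rule infsum_cong)
      fix p assume "p \<in> A \<times> A"
      then obtain j k where "p = (j, k)" "j \<in> A" "k \<in> A"
        by blast
      then show "d n p = c p + (c \<circ> prod.swap) p"
        using anti[of j k] by (simp add: d_def c_def algebra_simps)
    qed
    ultimately have "infsum (d n) (A \<times> A) = 2 * infsum c (A \<times> A)"
      using infsum_add[OF c c'] by simp
    also have "infsum c (A \<times> A) = (\<Sum>\<^sub>\<infinity>j\<in>A. \<tau> n j * b j)"
      using infsum_Sigma_banach[OF c] by (simp add: c_def b_def infsum_cmult_right')
    finally show ?thesis .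
  qed
  ultimately have "(\<lambda>n. infsum (d n) (A \<times> A)) \<longlonglongrightarrow> 2 * infsum b A"
    using tendsto_mult_left by force
  with lim0 show ?thesis
    using LIMSEQ_unique by (fastforce simp: b_def)
qed

section \<open>Orthonormal bases\<close>

lemma cinner_Cauchy_Schwarz: "cmod (cinner x y) \<le> norm x * norm (y::'a::complex_inner)"
proof (cases "y = 0")
  case False
  define p where "p = (cinner x y / complex_of_real ((norm y)\<^sup>2)) *\<^sub>C y"
  have "cinner (x - p) y = 0"
    using False by (simp add: p_def cinner_diff_left cinner_scaleC_left cinner_self)
  then have "cinner (x - p) p = 0"
    by (simp add: p_def cinner_scaleC_right)
  then have "cinner (x - p) (x - p) = cinner x x - cinner p x"
    by (simp add: cinner_diff_right cinner_diff_left)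
  also have "\<dots> = complex_of_real ((norm x)\<^sup>2 - (cmod (cinner x y))\<^sup>2 / (norm y)\<^sup>2)"
    by (simp add: p_def cinner_scaleC_left cinner_self cinner_commute[of y x]
        flip: complex_norm_square)
  finally have "(norm (x - p))\<^sup>2 = (norm x)\<^sup>2 - (cmod (cinner x y))\<^sup>2 / (norm y)\<^sup>2"
    unfolding cinner_self of_real_eq_iff .
  then have "(cmod (cinner x y))\<^sup>2 / (norm y)\<^sup>2 \<le> (norm x)\<^sup>2"
    by (smt (verit) zero_le_power2)
  then have "(cmod (cinner x y))\<^sup>2 \<le> (norm x * norm y)\<^sup>2"
    using False by (simp add: power_mult_distrib divide_le_eq)
  then show ?thesis
    by (rule power2_le_imp_le) simp
qed simp

lemma bounded_linear_cinner_left: "bounded_linear (\<lambda>x. cinner x (y::'a::complex_inner))"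
proof (rule bounded_linear_intro[where K = "norm y"])
  show "cinner (r *\<^sub>R x) y = r *\<^sub>R cinner x y" for r x
    unfolding scaleR_scaleC[of r x] cinner_scaleC_left scaleR_conv_of_real ..
qed (simp_all add: cinner_add_left cinner_Cauchy_Schwarz)

lemma norm_scaleC: "norm (a *\<^sub>C x) = cmod a * norm (x::'a::complex_inner)"
proof -
  have "complex_of_real ((norm (a *\<^sub>C x))\<^sup>2) = (a * cnj a) * cinner x x"
    by (simp only: cinner_self[symmetric] cinner_scaleC_left cinner_scaleC_right
        mult.assoc mult.left_commute)
  also have "\<dots> = complex_of_real ((cmod a * norm x)\<^sup>2)"
    by (simp only: cinner_self complex_norm_square[symmetric] of_real_mult[symmetric]
        power_mult_distrib)
  finally show ?thesis
    unfolding of_real_eq_iff by (rule power2_eq_imp_eq) simp_all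
qed

lemma cinner_sum_left: "cinner (sum f F) y = (\<Sum>i\<in>F. cinner (f i) (y::'a::complex_inner))"
  by (induction F rule: infinite_finite_induct) (simp_all add: cinner_add_left)

lemma norm_Pythagoras:
  assumes "cinner x y = (0::complex)"
  shows "(norm (x + y))\<^sup>2 = (norm x)\<^sup>2 + (norm (y::'a::complex_inner))\<^sup>2"
proof -
  have "cinner (x + y) (x + y) = cinner x x + cinner y y"
    using assms cinner_commute[of y x] by (simp add: cinner_add_left cinner_add_right)
  then show ?thesis
    unfolding cinner_self by (simp only: of_real_eq_iff flip: of_real_add)
qed

lemma orthonormal_basisD:
  assumes "orthonormal_basis I \<phi>"
  shows "i \<in> I \<Longrightarrow> j \<in> I \<Longrightarrow> cinner (\<phi> i) (\<phi> j) = (if i = j then 1 else 0)"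
    and "closure (complex_vector.span (\<phi> ` I)) = UNIV"
  using assms by (simp_all add: orthonormal_basis_def)

lemma orthonormal_basis_norm:
  assumes "orthonormal_basis I \<phi>" "i \<in> I"
  shows "norm (\<phi> i) = 1"
proof -
  have "complex_of_real ((norm (\<phi> i))\<^sup>2) = complex_of_real 1"
    using orthonormal_basisD(1)[OF assms(1,2,2)] unfolding cinner_self by simp
  then show ?thesis
    by (simp only: of_real_eq_iff power2_eq_1_iff) (smt (verit) norm_ge_zero)
qed

lemma orthonormal_expansion_best_approximation:
  fixes \<phi> :: "'i \<Rightarrow> 'a::complex_inner"
  assumes basis: "orthonormal_basis I \<phi>" and F: "finite F" "F \<subseteq> I"
    and s: "s \<in> complex_vector.span (\<phi> ` F)"
  shows "norm (x - (\<Sum>i\<in>F. cinner x (\<phi> i) *\<^sub>C \<phi> i)) \<le> norm (x - s)"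
proof -
  define p where "p = (\<Sum>i\<in>F. cinner x (\<phi> i) *\<^sub>C \<phi> i)"
  have perp: "cinner (x - p) (\<phi> k) = 0" if "k \<in> F" for k
  proof -
    have "cinner p (\<phi> k) = (\<Sum>i\<in>F. cinner x (\<phi> i) * (if i = k then 1 else 0))"
      unfolding p_def cinner_sum_left cinner_scaleC_left
      using F(2) that by (intro sum.cong) (simp_all add: subset_iff orthonormal_basisD(1)[OF basis])
    then show ?thesis
      using F that by (simp add: cinner_diff_left if_distrib cong: if_cong)
  qed
  have orth: "cinner (x - p) v = 0" if "v \<in> complex_vector.span (\<phi> ` F)" for v
    using that
    by (induction rule: complex_vector.span_induct_alt)
       (auto simp: cinner_add_right cinner_scaleC_right perp)
  have "p \<in> complex_vector.span (\<phi> ` F)"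
    unfolding p_def
    by (intro complex_vector.span_sum complex_vector.span_scale complex_vector.span_base) auto
  then have "p - s \<in> complex_vector.span (\<phi> ` F)"
    using s by (rule complex_vector.span_diff)
  from norm_Pythagoras[OF orth[OF this]]
  have "(norm (x - p))\<^sup>2 \<le> (norm (x - s))\<^sup>2"
    by simp
  then show ?thesis
    unfolding p_def by (rule power2_le_imp_le) simp
qed

text \<open>Density of the span supplies one finite combination near \<open>x\<close>; by best approximation the
  partial sums over all larger finite index sets are at least as close.\<close>

lemma orthonormal_basis_expansion:
  fixes \<phi> :: "'i \<Rightarrow> 'a::complex_inner"
  assumes basis: "orthonormal_basis I \<phi>"
  shows "((\<lambda>i. cinner x (\<phi> i) *\<^sub>C \<phi> i) has_sum x) I"
  unfolding has_sum_def tendsto_iff eventually_finite_subsets_at_top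
proof (intro allI impI)
  fix e :: real assume "e > 0"
  then obtain s where s: "s \<in> complex_vector.span (\<phi> ` I)" "dist s x < e"
    using orthonormal_basisD(2)[OF basis] closure_approachable[of x] by blast
  obtain t r where t: "finite t" "t \<subseteq> \<phi> ` I" "s = (\<Sum>v\<in>t. r v *\<^sub>C v)"
    using s(1) unfolding complex_vector.span_explicit by blast
  obtain F where F: "F \<subseteq> I" "finite F" "t = \<phi> ` F"
    using finite_subset_image[OF t(1,2)] by blast
  have "dist (\<Sum>i\<in>F'. cinner x (\<phi> i) *\<^sub>C \<phi> i) x < e"
    if F': "finite F'" "F \<subseteq> F'" "F' \<subseteq> I" for F'
  proof -
    have "t \<subseteq> \<phi> ` F'"
      using F F' by auto
    then have "s \<in> complex_vector.span (\<phi> ` F')"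
      unfolding t(3)
      by (intro complex_vector.span_sum complex_vector.span_scale complex_vector.span_base) auto
    from orthonormal_expansion_best_approximation[OF basis F'(1,3) this, of x] s(2)
    show ?thesis
      by (simp add: dist_norm norm_minus_commute)
  qed
  then show "\<exists>X. finite X \<and> X \<subseteq> I \<and>
      (\<forall>Y. finite Y \<and> X \<subseteq> Y \<and> Y \<subseteq> I \<longrightarrow> dist (\<Sum>i\<in>Y. cinner x (\<phi> i) *\<^sub>C \<phi> i) x < e)"
    using F by blast
qed

lemma Parseval:
  fixes \<phi> :: "'i \<Rightarrow> 'a::complex_inner"
  assumes "orthonormal_basis I \<phi>"
  shows "((\<lambda>i. cinner x (\<phi> i) * cnj (cinner y (\<phi> i))) has_sum cinner x y) I"
  using has_sum_bounded_linear[OF bounded_linear_cinner_left[of y]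
      orthonormal_basis_expansion[OF assms, of x]]
  by (simp add: cinner_scaleC_left flip: cinner_commute)

lemma orthonormal_basis_inj:
  assumes basis: "orthonormal_basis I \<phi>"
  shows "inj_on \<phi> I"
  by (rule inj_onI) (metis orthonormal_basisD(1)[OF basis] zero_neq_one)

lemma orthonormal_independent:
  assumes basis: "orthonormal_basis I \<phi>"
  shows "complex_vector.independent (\<phi> ` I)"
  unfolding complex_vector.dependent_explicit
proof safe
  fix t u v
  assume t: "finite t" "t \<subseteq> \<phi> ` I" "(\<Sum>v\<in>t. u v *\<^sub>C v) = 0" and v: "v \<in> t" "u v \<noteq> 0"
  have "cinner v' v = (if v' = v then 1 else 0)" if v': "v' \<in> t" for v'
  proof -
    obtain i j where "i \<in> I" "v' = \<phi> i" "j \<in> I" "v = \<phi> j"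
      using t(2) v(1) v' by blast
    then show ?thesis
      using orthonormal_basisD(1)[OF basis] inj_onD[OF orthonormal_basis_inj[OF basis]] by auto
  qed
  then have "cinner (\<Sum>v\<in>t. u v *\<^sub>C v) v = (\<Sum>v'\<in>t. u v' * (if v' = v then 1 else 0))"
    unfolding cinner_sum_left cinner_scaleC_left by (intro sum.cong) auto
  then show False
    using t v by (simp add: if_distrib cong: if_cong)
qed



section \<open>Eigenbases of self-adjoint operators\<close>

locale eigenbasis =
  fixes H :: "'a::complex_inner operator" and I :: "'i set"
    and \<phi> :: "'i \<Rightarrow> 'a" and ev :: "'i \<Rightarrow> real"
  assumes self_adjoint: "self_adjoint H"
    and basis: "orthonormal_basis I \<phi>"
    and eigenvector: "j \<in> I \<Longrightarrow> \<phi> j \<in> op_dom H"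
      "j \<in> I \<Longrightarrow> H \<cdot> \<phi> j = complex_of_real (ev j) *\<^sub>C \<phi> j"
begin

lemma subspace_dom: "complex_vector.subspace (op_dom H)"
  and apply_add: "x \<in> op_dom H \<Longrightarrow> y \<in> op_dom H \<Longrightarrow> H \<cdot> (x + y) = H \<cdot> x + H \<cdot> y"
  and apply_scaleC: "x \<in> op_dom H \<Longrightarrow> H \<cdot> (a *\<^sub>C x) = a *\<^sub>C (H \<cdot> x)"
  using self_adjoint by (simp_all add: self_adjoint_def linear_operator_def)

lemma dense: "densely_defined H"
  using self_adjoint by (simp add: self_adjoint_def)

lemma H_symmetric:
  assumes "x \<in> op_dom H" "y \<in> op_dom H"
  shows "cinner (H \<cdot> x) y = cinner x (H \<cdot> y)"
  using cinner_adj[OF dense assms(1), of y] assms(2) self_adjoint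
  by (simp add: self_adjoint_def)

lemma cinner_shifted:
  assumes "x \<in> op_dom H" "k \<in> I"
  shows "cinner (H \<cdot> x - complex_of_real l *\<^sub>C x) (\<phi> k) = complex_of_real (ev k - l) * cinner x (\<phi> k)"
  using assms H_symmetric[OF assms(1) eigenvector(1)[OF assms(2)]]
  by (simp add: eigenvector cinner_diff_left cinner_scaleC_left cinner_scaleC_right algebra_simps)

lemma shifted_form_has_sum:
  assumes x: "x \<in> op_dom H"
  shows "((\<lambda>k. complex_of_real ((ev k - l) * (cmod (cinner x (\<phi> k)))\<^sup>2)) has_sum
           cinner (H \<cdot> x - complex_of_real l *\<^sub>C x) x) I"
proof -
  have "complex_of_real ((ev k - l) * (cmod (cinner x (\<phi> k)))\<^sup>2) =
      cinner (H \<cdot> x - complex_of_real l *\<^sub>C x) (\<phi> k) * cnj (cinner x (\<phi> k))" if "k \<in> I" for k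
    unfolding cinner_shifted[OF x that] of_real_mult complex_norm_square by (simp only: mult.assoc)
  then show ?thesis
    using Parseval[OF basis, of "H \<cdot> x - complex_of_real l *\<^sub>C x" x] by (simp cong: has_sum_cong)
qed

lemma shifted_norm_has_sum:
  assumes x: "x \<in> op_dom H"
  shows "((\<lambda>k. (ev k - l)\<^sup>2 * (cmod (cinner x (\<phi> k)))\<^sup>2) has_sum
           (norm (H \<cdot> x - complex_of_real l *\<^sub>C x))\<^sup>2) I"
proof -
  define y where "y = H \<cdot> x - complex_of_real l *\<^sub>C x"
  have "cinner y (\<phi> k) * cnj (cinner y (\<phi> k)) =
      complex_of_real ((ev k - l)\<^sup>2 * (cmod (cinner x (\<phi> k)))\<^sup>2)" if "k \<in> I" for k
    unfolding complex_norm_square[symmetric] y_def cinner_shifted[OF x that]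
    by (simp only: norm_mult norm_of_real power_mult_distrib power2_abs)
  then have "((\<lambda>k. complex_of_real ((ev k - l)\<^sup>2 * (cmod (cinner x (\<phi> k)))\<^sup>2)) has_sum
      complex_of_real ((norm y)\<^sup>2)) I"
    using Parseval[OF basis, of y y] unfolding cinner_self by (simp cong: has_sum_cong)
  then show ?thesis
    unfolding has_sum_of_real_iff y_def .
qed

text \<open>Eigenvalues cannot accumulate anywhere: not at a point of the spectrum, which is isolated,
  and not at a point \<open>l\<close> of the resolvent set, where the resolvent bound
  \<open>1 = \<parallel>\<phi>\<^sub>j\<parallel> \<le> C |\<lambda>\<^sub>j - l|\<close> keeps them away.  Finite multiplicity bounds the number of
  basis vectors for each eigenvalue.\<close>

lemma finite_bounded_eigenvalues:
  assumes disc: "purely_discrete_spectrum H"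
  shows "finite {j \<in> I. \<bar>ev j - z\<bar> \<le> R}"
proof -
  define B where "B = {j \<in> I. \<bar>ev j - z\<bar> \<le> R}"
  define E where "E = (\<lambda>j. complex_of_real (ev j)) ` B"
  have spec: "complex_of_real (ev j) \<in> spectrum H" if "j \<in> I" for j
  proof -
    have zero: "0 \<in> op_dom H" "H \<cdot> 0 = 0"
      using complex_vector.subspace_0[OF subspace_dom] apply_scaleC[of 0 0] by simp_all
    have "\<phi> j \<noteq> 0"
      using orthonormal_basis_norm[OF basis that] by auto
    then have "\<not> inj_on (\<lambda>x. H \<cdot> x - complex_of_real (ev j) *\<^sub>C x) (op_dom H)"
      using eigenvector[OF that] zero inj_onD[of _ _ "\<phi> j" 0] by fastforce
    then show ?thesis
      by (auto simp: spectrum_def resolvent_set_def bij_betw_def)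
  qed
  have "finite E"
  proof (rule ccontr)
    assume "infinite E"
    moreover have "E \<subseteq> cball 0 (\<bar>z\<bar> + R)"
      by (auto simp: E_def B_def)
    ultimately obtain l where l: "l islimpt E"
      using Heine_Borel_imp_Bolzano_Weierstrass[OF compact_cball] by blast
    show False
    proof (cases "l \<in> spectrum H")
      case True
      have "E \<subseteq> spectrum H"
        using spec by (auto simp: E_def B_def)
      then have "l islimpt spectrum H"
        using l islimpt_subset by blast
      then show False
        using True disc by (auto simp: purely_discrete_spectrum_def isolated_in_islimpt_iff)
    next
      case False
      then obtain C where C: "\<And>x. x \<in> op_dom H \<Longrightarrow> norm x \<le> C * norm (H \<cdot> x - l *\<^sub>C x)"
        by (auto simp: spectrum_def resolvent_set_def)
      have "0 < 1 / (\<bar>C\<bar> + 1)"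
        by (simp add: add_nonneg_pos)
      then obtain j where j: "j \<in> B" "dist (complex_of_real (ev j)) l < 1 / (\<bar>C\<bar> + 1)"
        using l[unfolded islimpt_approachable, rule_format, of "1 / (\<bar>C\<bar> + 1)"]
        by (auto simp: E_def)
      then have jI: "j \<in> I" by (simp add: B_def)
      have "1 \<le> C * cmod (complex_of_real (ev j) - l)"
        using C[of "\<phi> j"] eigenvector[OF jI] orthonormal_basis_norm[OF basis jI]
        by (simp add: norm_scaleC flip: complex_vector.scale_left_diff_distrib)
      also have "\<dots> \<le> (\<bar>C\<bar> + 1) * cmod (complex_of_real (ev j) - l)"
        by (intro mult_right_mono) auto
      also have "\<dots> < 1"
        using j(2) by (simp add: dist_norm field_simps)
      finally show False by simp
    qed
  qed
  moreover have "finite {j \<in> B. complex_of_real (ev j) = e}" if "e \<in> E" for e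
  proof -
    have "e \<in> spectrum H"
      using that spec by (auto simp: E_def B_def)
    then obtain S where S: "finite S" "eigenspace H e \<subseteq> complex_vector.span S"
      using disc unfolding purely_discrete_spectrum_def by blast
    define F where "F = {j \<in> B. complex_of_real (ev j) = e}"
    have "F \<subseteq> I"
      by (auto simp: F_def B_def)
    then have "\<phi> ` F \<subseteq> complex_vector.span S"
      using S(2) eigenvector by (fastforce simp: F_def eigenspace_def)
    moreover have "complex_vector.independent (\<phi> ` F)"
      using orthonormal_independent[OF basis] \<open>F \<subseteq> I\<close>
      by (meson complex_vector.independent_mono image_mono)
    ultimately have "finite (\<phi> ` F)"
      using complex_vector.independent_span_bound[OF S(1)] by blast
    then show ?thesis
      using finite_imageD[of \<phi> F] inj_on_subset[OF orthonormal_basis_inj[OF basis] \<open>F \<subseteq> I\<close>]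
      by (simp add: F_def)
  qed
  ultimately have "finite (\<Union>e\<in>E. {j \<in> B. complex_of_real (ev j) = e})"
    by (rule finite_UN_I)
  also have "(\<Union>e\<in>E. {j \<in> B. complex_of_real (ev j) = e}) = B"
    by (auto simp: E_def)
  finally show ?thesis
    by (simp add: B_def)
qed

text \<open>This set lies in the domain of \<open>[H, S]\<close> for every \<open>S\<close> that maps the domain of \<open>H\<close> to
  itself, so such commutators are densely defined and have adjoints.\<close>

lemma dense_square_domain: "closure {x \<in> op_dom H. H \<cdot> x \<in> op_dom H} = UNIV"
proof -
  have "H \<cdot> 0 = 0"
    using apply_scaleC[of 0 0] complex_vector.subspace_0[OF subspace_dom] by simp
  then have "complex_vector.subspace {x \<in> op_dom H. H \<cdot> x \<in> op_dom H}"
    using subspace_dom by (auto simp: complex_vector.subspace_def apply_add apply_scaleC)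
  moreover have "\<phi> ` I \<subseteq> {x \<in> op_dom H. H \<cdot> x \<in> op_dom H}"
    using eigenvector complex_vector.subspace_scale[OF subspace_dom] by auto
  ultimately have "complex_vector.span (\<phi> ` I) \<subseteq> {x \<in> op_dom H. H \<cdot> x \<in> op_dom H}"
    using complex_vector.span_minimal by blast
  then show ?thesis
    using closure_mono orthonormal_basisD(2)[OF basis] by blast
qed

end

section \<open>Commutators with a formally adjoint pair\<close>

text \<open>The pair \<open>G\<close>, \<open>G\<^sup>*\<close> enters symmetrically once each operator is known to act as the adjoint
  of the other on the domain of \<open>H\<close>.  The two double commutators are then instances of one
  statement, with the roles of \<open>S\<close> and \<open>T\<close> exchanged.\<close>

locale formally_adjoint_pair = eigenbasis H I \<phi> ev
  for H :: "'a::complex_inner operator" and I :: "'i set"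
    and \<phi> :: "'i \<Rightarrow> 'a" and ev :: "'i \<Rightarrow> real" +
  fixes S T :: "'a operator"
  assumes invariant: "x \<in> op_dom H \<Longrightarrow> S \<cdot> x \<in> op_dom H" "x \<in> op_dom H \<Longrightarrow> T \<cdot> x \<in> op_dom H"
    and domains: "op_dom H \<subseteq> op_dom S" "op_dom H \<subseteq> op_dom T"
    and pairing: "x \<in> op_dom S \<Longrightarrow> v \<in> op_dom H \<Longrightarrow> cinner (S \<cdot> x) v = cinner x (T \<cdot> v)"
      "x \<in> op_dom T \<Longrightarrow> v \<in> op_dom H \<Longrightarrow> cinner (T \<cdot> x) v = cinner x (S \<cdot> v)"
begin

lemma swapped: "formally_adjoint_pair H I \<phi> ev T S"
  by unfold_locales (use invariant domains pairing in blast)+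

text \<open>Linearity of \<open>S\<close> on multiples of \<open>\<phi>\<^sub>j\<close> comes from the pairing with \<open>T\<close>: the difference
  of the two sides is orthogonal to the dense domain of \<open>H\<close>.\<close>

lemma commutator_eigenvector:
  assumes j: "j \<in> I"
  shows "commutator H S \<cdot> \<phi> j = H \<cdot> S \<cdot> \<phi> j - complex_of_real (ev j) *\<^sub>C (S \<cdot> \<phi> j)"
proof -
  have \<phi>: "\<phi> j \<in> op_dom H"
    by (rule eigenvector(1)[OF j])
  have \<phi>': "complex_of_real (ev j) *\<^sub>C \<phi> j \<in> op_dom H"
    by (rule complex_vector.subspace_scale[OF subspace_dom \<phi>])
  have "cinner v (S \<cdot> (complex_of_real (ev j) *\<^sub>C \<phi> j) - complex_of_real (ev j) *\<^sub>C (S \<cdot> \<phi> j)) = 0"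
    if "v \<in> op_dom H" for v
    using pairing(2)[OF _ \<phi>', of v] pairing(2)[OF _ \<phi>, of v] that domains(2)
    by (auto simp: cinner_diff_right cinner_scaleC_right)
  then have "S \<cdot> (complex_of_real (ev j) *\<^sub>C \<phi> j) - complex_of_real (ev j) *\<^sub>C (S \<cdot> \<phi> j) = 0"
    using dense_orthogonal_zero dense unfolding densely_defined_def by blast
  then show ?thesis
    by (simp add: commutator_def op_diff_def op_comp_def eigenvector[OF j])
qed

text \<open>Formally \<open>[H, S]\<^sup>* = - [H, T]\<close>; on eigenvectors the identity holds with the actual
  adjoint.\<close>

lemma adj_commutator_eigenvector:
  assumes j: "j \<in> I"
  shows "adj (commutator H S) \<cdot> \<phi> j = complex_of_real (ev j) *\<^sub>C (T \<cdot> \<phi> j) - H \<cdot> T \<cdot> \<phi> j"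
proof (rule adj_eqI(2))
  have "{x \<in> op_dom H. H \<cdot> x \<in> op_dom H} \<subseteq> op_dom (commutator H S)"
    using invariant(1) domains(1) by (auto simp: commutator_def op_diff_def op_comp_def)
  then show "densely_defined (commutator H S)"
    using closure_mono dense_square_domain unfolding densely_defined_def by blast
next
  fix x assume "x \<in> op_dom (commutator H S)"
  then have x: "x \<in> op_dom H" "S \<cdot> x \<in> op_dom H" "x \<in> op_dom S" "H \<cdot> x \<in> op_dom S"
    by (auto simp: commutator_def op_diff_def op_comp_def)
  note \<phi> = eigenvector(1)[OF j]
  have "cinner (H \<cdot> S \<cdot> x) (\<phi> j) = cinner x (complex_of_real (ev j) *\<^sub>C (T \<cdot> \<phi> j))"
    using H_symmetric[OF x(2) \<phi>] pairing(1)[OF x(3) \<phi>]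
    by (simp add: eigenvector(2)[OF j] cinner_scaleC_right)
  moreover have "cinner (S \<cdot> H \<cdot> x) (\<phi> j) = cinner x (H \<cdot> T \<cdot> \<phi> j)"
    using pairing(1)[OF x(4) \<phi>] H_symmetric[OF x(1) invariant(2)[OF \<phi>]] by simp
  ultimately show "cinner (commutator H S \<cdot> x) (\<phi> j) =
      cinner x (complex_of_real (ev j) *\<^sub>C (T \<cdot> \<phi> j) - H \<cdot> T \<cdot> \<phi> j)"
    by (simp add: commutator_def op_diff_def op_comp_def cinner_diff_left cinner_diff_right)
qed

lemma adj_eq_partner:
  assumes "v \<in> op_dom H"
  shows "adj T \<cdot> v = S \<cdot> v"
proof (rule adj_eqI(2))
  show "densely_defined T"
    using dense closure_mono[OF domains(2)] unfolding densely_defined_def by blast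
qed (rule pairing(2)[OF _ assms])

text \<open>Moving \<open>T\<close> and \<open>[H, S]\<close> to the other side splits the form into
  \<open>\<langle>(H - \<lambda>\<^sub>j)S\<phi>\<^sub>j, S\<phi>\<^sub>j\<rangle> + \<langle>(H - \<lambda>\<^sub>j)T\<phi>\<^sub>j, T\<phi>\<^sub>j\<rangle>\<close>.  The result is symmetric in
  \<open>S\<close> and \<open>T\<close>, so the double commutator with \<open>S\<close> and \<open>T\<close> exchanged has the same value.\<close>

lemma commutator_form_has_sum:
  assumes j: "j \<in> I"
  shows "((\<lambda>k. complex_of_real ((ev k - ev j) *
             ((cmod (cinner (S \<cdot> \<phi> j) (\<phi> k)))\<^sup>2 + (cmod (cinner (T \<cdot> \<phi> j) (\<phi> k)))\<^sup>2)))
           has_sum commutator_form T (commutator H S) (\<phi> j) (\<phi> j)) I"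
proof -
  note \<phi> = eigenvector(1)[OF j]
  let ?s = "\<lambda>x. H \<cdot> x - complex_of_real (ev j) *\<^sub>C x"
  have "cinner (T \<cdot> \<phi> j) (?s (T \<cdot> \<phi> j)) = cinner (?s (T \<cdot> \<phi> j)) (T \<cdot> \<phi> j)"
    using H_symmetric[OF invariant(2)[OF \<phi>] invariant(2)[OF \<phi>]]
    by (simp add: cinner_diff_left cinner_diff_right cinner_scaleC_left cinner_scaleC_right)
  then have "commutator_form T (commutator H S) (\<phi> j) (\<phi> j) =
      cinner (?s (S \<cdot> \<phi> j)) (S \<cdot> \<phi> j) + cinner (?s (T \<cdot> \<phi> j)) (T \<cdot> \<phi> j)"
    by (simp add: commutator_form_def commutator_eigenvector[OF j] adj_eq_partner[OF \<phi>]
        adj_commutator_eigenvector[OF j] cinner_diff_right)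
  then show ?thesis
    using has_sum_add[OF shifted_form_has_sum[OF invariant(1)[OF \<phi>]]
        shifted_form_has_sum[OF invariant(2)[OF \<phi>]]]
    by (simp add: distrib_left)
qed

lemma commutator_norms_has_sum:
  assumes j: "j \<in> I"
  shows "((\<lambda>k. (ev k - ev j)\<^sup>2 *
             ((cmod (cinner (S \<cdot> \<phi> j) (\<phi> k)))\<^sup>2 + (cmod (cinner (T \<cdot> \<phi> j) (\<phi> k)))\<^sup>2))
           has_sum (norm (commutator H S \<cdot> \<phi> j))\<^sup>2 + (norm (commutator H T \<cdot> \<phi> j))\<^sup>2) I"
  using has_sum_add[OF shifted_norm_has_sum[OF invariant(1)] shifted_norm_has_sum[OF invariant(2)],
      OF eigenvector(1)[OF j] eigenvector(1)[OF j], of "ev j" "ev j"]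
  by (simp add: distrib_left commutator_eigenvector[OF j]
      formally_adjoint_pair.commutator_eigenvector[OF swapped j])

lemma matrix_entries_symmetric:
  assumes "j \<in> I" "k \<in> I"
  shows "cmod (cinner (T \<cdot> \<phi> j) (\<phi> k)) = cmod (cinner (S \<cdot> \<phi> k) (\<phi> j))"
proof -
  have "cinner (T \<cdot> \<phi> j) (\<phi> k) = cinner (\<phi> j) (S \<cdot> \<phi> k)"
    using pairing(2) domains(2) eigenvector(1) assms by blast
  then show ?thesis
    by (metis cinner_commute complex_mod_cnj)
qed

end

section \<open>The sum rule\<close>

theorem theorem2p1:
  fixes H G :: "'a::complex_hilbert_space operator"
    and I :: "'i set" and \<phi> :: "'i \<Rightarrow> 'a" and ev :: "'i \<Rightarrow> real"
    and J :: "real set" and z :: real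
  assumes "self_adjoint H" and "purely_discrete_spectrum H"
    and "orthonormal_basis I \<phi>"
    and "\<And>j. j \<in> I \<Longrightarrow> \<phi> j \<in> op_dom H \<and> H \<cdot> \<phi> j = complex_of_real (ev j) *\<^sub>C \<phi> j"
    and "linear_operator G"
    and "op_app G ` op_dom H \<subseteq> op_dom H" and "op_dom H \<subseteq> op_dom G"
    and "op_app (adj G) ` op_dom H \<subseteq> op_dom H" and "op_dom H \<subseteq> op_dom (adj G)"
    and "complex_of_real ` J \<subseteq> spectrum H"
    and "(\<lambda>j. complex_of_real ((z - ev j)\<^sup>2) *
            (commutator_form (adj G) (commutator H G) (\<phi> j) (\<phi> j) +
             commutator_form G (commutator H (adj G)) (\<phi> j) (\<phi> j)))
          summable_on {j \<in> I. ev j \<in> J}"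
    and "(\<lambda>j. (z - ev j) *
            ((norm (commutator H G \<cdot> \<phi> j))\<^sup>2 + (norm (commutator H (adj G) \<cdot> \<phi> j))\<^sup>2))
          summable_on {j \<in> I. ev j \<in> J}"
    and "(\<lambda>j. \<Sum>\<^sub>\<infinity>k\<in>{k \<in> I. ev k \<notin> J}. (z - ev j) * (z - ev k) * (ev k - ev j) *
            ((cmod (cinner (G \<cdot> \<phi> j) (\<phi> k)))\<^sup>2 + (cmod (cinner (adj G \<cdot> \<phi> j) (\<phi> k)))\<^sup>2))
          summable_on {j \<in> I. ev j \<in> J}"
  shows "(1 / 2) * (\<Sum>\<^sub>\<infinity>j\<in>{j \<in> I. ev j \<in> J}. complex_of_real ((z - ev j)\<^sup>2) *
            (commutator_form (adj G) (commutator H G) (\<phi> j) (\<phi> j) +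
             commutator_form G (commutator H (adj G)) (\<phi> j) (\<phi> j)))
       - complex_of_real (\<Sum>\<^sub>\<infinity>j\<in>{j \<in> I. ev j \<in> J}. (z - ev j) *
            ((norm (commutator H G \<cdot> \<phi> j))\<^sup>2 + (norm (commutator H (adj G) \<cdot> \<phi> j))\<^sup>2))
       = complex_of_real (\<Sum>\<^sub>\<infinity>j\<in>{j \<in> I. ev j \<in> J}. \<Sum>\<^sub>\<infinity>k\<in>{k \<in> I. ev k \<notin> J}.
            (z - ev j) * (z - ev k) * (ev k - ev j) *
            ((cmod (cinner (G \<cdot> \<phi> j) (\<phi> k)))\<^sup>2 + (cmod (cinner (adj G \<cdot> \<phi> j) (\<phi> k)))\<^sup>2))"
proof -
  interpret eigenbasis H I \<phi> ev
    using assms(1,3,4) by unfold_locales blast+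
  have pair: "cinner (G \<cdot> x) v = cinner x (adj G \<cdot> v)"
    if "x \<in> op_dom G" "v \<in> op_dom (adj G)" for x v
    using cinner_adj[OF _ that] dense closure_mono[OF \<open>op_dom H \<subseteq> op_dom G\<close>]
    unfolding densely_defined_def by blast
  have pair': "cinner (adj G \<cdot> x) v = cinner x (G \<cdot> v)"
    if "x \<in> op_dom (adj G)" "v \<in> op_dom G" for x v
    using pair[OF that(2,1)] by (metis cinner_commute)
  interpret formally_adjoint_pair H I \<phi> ev G "adj G"
    by unfold_locales (use assms(6-9) pair pair' in blast)+
  define A where "A = {j \<in> I. ev j \<in> J}"
  define K where "K = {k \<in> I. ev k \<notin> J}"
  define w where "w j k = (cmod (cinner (G \<cdot> \<phi> j) (\<phi> k)))\<^sup>2 + (cmod (cinner (adj G \<cdot> \<phi> j) (\<phi> k)))\<^sup>2"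
    for j k
  define a where "a j k = (z - ev j) * (z - ev k) * (ev k - ev j) * w j k" for j k
  define \<beta> where "\<beta> j = (norm (commutator H G \<cdot> \<phi> j))\<^sup>2 + (norm (commutator H (adj G) \<cdot> \<phi> j))\<^sup>2" for j
  define \<gamma> where "\<gamma> j = (\<Sum>\<^sub>\<infinity>k\<in>I. (ev k - ev j) * w j k)" for j
  have AI: "A \<subseteq> I" and I: "I = A \<union> K" "A \<inter> K = {}"
    by (auto simp: A_def K_def)
  have \<gamma>: "((\<lambda>k. (ev k - ev j) * w j k) has_sum \<gamma> j) I"
    and form: "commutator_form (adj G) (commutator H G) (\<phi> j) (\<phi> j) = complex_of_real (\<gamma> j)"
    and form': "commutator_form G (commutator H (adj G)) (\<phi> j) (\<phi> j) = complex_of_real (\<gamma> j)"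
    if j: "j \<in> I" for j
  proof -
    note c1 = commutator_form_has_sum[OF j, folded w_def]
    have c2: "((\<lambda>k. complex_of_real ((ev k - ev j) * w j k)) has_sum
        commutator_form G (commutator H (adj G)) (\<phi> j) (\<phi> j)) I"
      using formally_adjoint_pair.commutator_form_has_sum[OF swapped j]
      by (simp only: w_def add.commute)
    have "(\<lambda>k. (ev k - ev j) * w j k) summable_on I"
      using has_sum_Re[OF c1] by (auto simp: summable_on_def)
    then show g: "((\<lambda>k. (ev k - ev j) * w j k) has_sum \<gamma> j) I"
      unfolding \<gamma>_def by (rule has_sum_infsum)
    show "commutator_form (adj G) (commutator H G) (\<phi> j) (\<phi> j) = complex_of_real (\<gamma> j)"
      "commutator_form G (commutator H (adj G)) (\<phi> j) (\<phi> j) = complex_of_real (\<gamma> j)"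
      using has_sum_unique[OF _ has_sum_of_real[OF g]] c1 c2 by blast+
  qed
  have \<beta>: "((\<lambda>k. (ev k - ev j)\<^sup>2 * w j k) has_sum \<beta> j) I" if "j \<in> I" for j
    using commutator_norms_has_sum[OF that] by (simp add: w_def \<beta>_def)
  \<comment> \<open>Here \<open>(z - \<lambda>\<^sub>j)(\<lambda>\<^sub>k - \<lambda>\<^sub>j) - (\<lambda>\<^sub>k - \<lambda>\<^sub>j)\<^sup>2 = (z - \<lambda>\<^sub>k)(\<lambda>\<^sub>k - \<lambda>\<^sub>j)\<close> merges the two
    commutator expressions.\<close>
  have row: "(a j has_sum (z - ev j)\<^sup>2 * \<gamma> j - (z - ev j) * \<beta> j) I" if j: "j \<in> I" for j
  proof -
    have "a j = (\<lambda>k. (z - ev j)\<^sup>2 * ((ev k - ev j) * w j k) + (ev j - z) * ((ev k - ev j)\<^sup>2 * w j k))"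
      by (rule ext) (simp add: a_def power2_eq_square algebra_simps)
    then show ?thesis
      using has_sum_add[OF has_sum_cmult_right[OF \<gamma>[OF j], of "(z - ev j)\<^sup>2"]
          has_sum_cmult_right[OF \<beta>[OF j], of "ev j - z"]]
      by (simp add: algebra_simps)
  qed
  have row_A: "a j summable_on A" and row_K: "a j summable_on K" if "j \<in> I" for j
    using row[OF that] I(1) summable_on_subset[of "a j" I] by (auto simp: summable_on_def)
  have split: "infsum (a j) A = (z - ev j)\<^sup>2 * \<gamma> j - (z - ev j) * \<beta> j - infsum (a j) K"
    if "j \<in> A" for j
  proof -
    have j: "j \<in> I"
      using that AI by blast
    show ?thesis
      using infsum_Un_disjoint[OF row_A[OF j] row_K[OF j] I(2)] infsumI[OF row[OF j]]
      unfolding I(1)[symmetric] by linarith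
  qed
  have sum\<gamma>: "(\<lambda>j. (z - ev j)\<^sup>2 * \<gamma> j) summable_on A"
    and form_sum: "(\<Sum>\<^sub>\<infinity>j\<in>A. complex_of_real ((z - ev j)\<^sup>2) *
            (commutator_form (adj G) (commutator H G) (\<phi> j) (\<phi> j) +
             commutator_form G (commutator H (adj G)) (\<phi> j) (\<phi> j)))
          = complex_of_real (2 * (\<Sum>\<^sub>\<infinity>j\<in>A. (z - ev j)\<^sup>2 * \<gamma> j))" (is "infsum ?f A = _")
  proof -
    have f: "?f j = complex_of_real (2 * ((z - ev j)\<^sup>2 * \<gamma> j))" if "j \<in> A" for j
      using that AI by (simp add: form form' subset_iff)
    have "(\<lambda>j. Re (?f j)) summable_on A"
      using assms(11) unfolding A_def by (rule summable_on_Re)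
    then have "(\<lambda>j. 2 * ((z - ev j)\<^sup>2 * \<gamma> j)) summable_on A"
      by (rule summable_on_cong[THEN iffD1, rotated]) (simp only: f Re_complex_of_real)
    from summable_on_cmult_right[OF this, of "1/2"]
    show s: "(\<lambda>j. (z - ev j)\<^sup>2 * \<gamma> j) summable_on A"
      by simp
    have "infsum ?f A = (\<Sum>\<^sub>\<infinity>j\<in>A. complex_of_real (2 * ((z - ev j)\<^sup>2 * \<gamma> j)))"
      by (rule infsum_cong) (rule f)
    also have "\<dots> = complex_of_real (2 * (\<Sum>\<^sub>\<infinity>j\<in>A. (z - ev j)\<^sup>2 * \<gamma> j))"
      by (intro infsumI has_sum_of_real has_sum_cmult_right has_sum_infsum s)
    finally show "infsum ?f A = complex_of_real (2 * (\<Sum>\<^sub>\<infinity>j\<in>A. (z - ev j)\<^sup>2 * \<gamma> j))" .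
  qed
  have sum\<beta>: "(\<lambda>j. (z - ev j) * \<beta> j) summable_on A"
    using assms(12) by (simp add: A_def \<beta>_def)
  have sumK: "(\<lambda>j. infsum (a j) K) summable_on A"
    using assms(13) by (simp add: A_def K_def a_def[abs_def] w_def)
  have sum\<gamma>\<beta>: "(\<lambda>j. (z - ev j)\<^sup>2 * \<gamma> j - (z - ev j) * \<beta> j) summable_on A"
    by (intro summable_on_diff sum\<gamma> sum\<beta>)
  \<comment> \<open>The transitions within \<open>J\<close> cancel.  Centring the eigenvalues at \<open>z\<close> gives \<open>a\<close> the form
    \<open>x\<^sub>j x\<^sub>k (x\<^sub>k - x\<^sub>j) w\<^sub>j\<^sub>k\<close>, because the two sign changes compensate.\<close>
  have "(\<Sum>\<^sub>\<infinity>j\<in>A. infsum (a j) A) = 0"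
  proof -
    have a: "a j k = (ev j - z) * (ev k - z) * ((ev k - z) - (ev j - z)) * w j k" for j k
      by (simp add: a_def algebra_simps)
    have sq: "(\<lambda>k. (ev k - ev j)\<^sup>2 * w j k) summable_on A" if "j \<in> A" for j
      using \<beta>[of j] that AI summable_on_subset[of "\<lambda>k. (ev k - ev j)\<^sup>2 * w j k" I A]
      by (auto simp: summable_on_def)
    have "(\<Sum>\<^sub>\<infinity>j\<in>A. \<Sum>\<^sub>\<infinity>k\<in>A. (ev j - z) * (ev k - z) * ((ev k - z) - (ev j - z)) * w j k) = 0"
    proof (rule antisymmetric_exchange_zero)
      show "finite {j \<in> A. \<bar>ev j - z\<bar> \<le> R}" for R
        by (rule finite_subset[OF _ finite_bounded_eigenvalues[OF assms(2), of z R]])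
           (auto simp: A_def)
      show "w j k = w k j" if "j \<in> A" "k \<in> A" for j k
        using matrix_entries_symmetric that AI by (simp add: w_def subset_iff)
      show "w j k \<ge> 0" for j k
        by (simp add: w_def)
      show "(\<lambda>k. ((ev k - z) - (ev j - z))\<^sup>2 * w j k) summable_on A" if "j \<in> A" for j
        using sq[OF that] by simp
      have "(\<lambda>j. \<bar>(z - ev j) * \<beta> j\<bar>) summable_on A"
        using sum\<beta> by (subst (asm) summable_on_iff_abs_summable_on_real) simp
      then show "(\<lambda>j. \<bar>ev j - z\<bar> * (\<Sum>\<^sub>\<infinity>k\<in>A. ((ev k - z) - (ev j - z))\<^sup>2 * w j k)) summable_on A"
      proof (rule summable_on_comparison_test)
        fix j assume j: "j \<in> A"
        have "(\<Sum>\<^sub>\<infinity>k\<in>A. (ev k - ev j)\<^sup>2 * w j k) \<le> \<beta> j"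
          using \<beta>[of j] j AI sq[OF j]
          by (intro has_sum_mono2[OF has_sum_infsum]) (auto simp: w_def)
        then show "\<bar>ev j - z\<bar> * (\<Sum>\<^sub>\<infinity>k\<in>A. ((ev k - z) - (ev j - z))\<^sup>2 * w j k)
            \<le> \<bar>(z - ev j) * \<beta> j\<bar>"
          by (auto simp: abs_mult \<beta>_def abs_minus_commute intro!: mult_left_mono)
        show "0 \<le> \<bar>ev j - z\<bar> * (\<Sum>\<^sub>\<infinity>k\<in>A. ((ev k - z) - (ev j - z))\<^sup>2 * w j k)"
          by (intro mult_nonneg_nonneg infsum_nonneg) (simp_all add: w_def)
      qed
      show "(\<lambda>k. (ev j - z) * (ev k - z) * ((ev k - z) - (ev j - z)) * w j k) summable_on A"
        if "j \<in> A" for j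
        using row_A[of j] that AI by (auto simp: a[abs_def])
      have "(\<lambda>j. infsum (a j) A) summable_on A"
        by (rule summable_on_cong[THEN iffD2, OF split summable_on_diff[OF sum\<gamma>\<beta> sumK]])
      then show "(\<lambda>j. \<Sum>\<^sub>\<infinity>k\<in>A. (ev j - z) * (ev k - z) * ((ev k - z) - (ev j - z)) * w j k)
          summable_on A"
        by (simp add: a[abs_def])
    qed
    then show ?thesis
      by (simp add: a[abs_def])
  qed
  moreover have "(\<Sum>\<^sub>\<infinity>j\<in>A. infsum (a j) A) = (\<Sum>\<^sub>\<infinity>j\<in>A. (z - ev j)\<^sup>2 * \<gamma> j)
      - (\<Sum>\<^sub>\<infinity>j\<in>A. (z - ev j) * \<beta> j) - (\<Sum>\<^sub>\<infinity>j\<in>A. infsum (a j) K)"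
    unfolding infsum_diff[OF sum\<gamma>\<beta> sumK, symmetric] infsum_diff[OF sum\<gamma> sum\<beta>, symmetric]
    by (rule infsum_cong) (rule split)
  ultimately have "(\<Sum>\<^sub>\<infinity>j\<in>A. (z - ev j)\<^sup>2 * \<gamma> j) - (\<Sum>\<^sub>\<infinity>j\<in>A. (z - ev j) * \<beta> j)
      = (\<Sum>\<^sub>\<infinity>j\<in>A. infsum (a j) K)"
    by simp
  then show ?thesis
    unfolding A_def[symmetric] K_def[symmetric] w_def[symmetric] a_def[symmetric] \<beta>_def[symmetric]
      form_sum
    by (simp flip: of_real_diff)
qed

end
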